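(* Let $E$ be an infinite dimensional locally convex space continuously included in $(C(\overline{\mathbb{D}}),\tau_p)$ and such that the evaluations $\{\delta_z: z\in\overline{\mathbb{D}}\}$ are linearly independent in $E'$. Let $\varphi\in A(\mathbb{D})$ with $\varphi(\overline{\mathbb{D}})\subseteq\overline{\mathbb{D}}$ and $w\in C(\overline{\mathbb{D}})$ be such that the weighted composition operator $C_{w,\varphi}:E\to E$, $f\mapsto w\cdot(f\circ\varphi)$, is well defined and continuous. Then $C_{w,\varphi}$ is not $\tau_p$-supercyclic on $E$. As a consequence, no weighted composition operator $C_{w,\varphi}$ is $\tau_p$-supercyclic on the disc algebra $A(\mathbb{D})$, nor on the analytic Lipschitz spaces $\mathrm{Lip}_\alpha(\mathbb{D})$, $0<\alpha\le 1$.
   Context: $\mathbb{D}$ is the open unit disc of $\mathbb{C}$ and $\overline{\mathbb{D}}$ its closure. $C(X)$ is the space of continuous complex functions on $X$ and $\tau_p$ is the topology of pointwise convergence on $X$ (here $X=\overline{\mathbb{D}}$). $\delta_z$ is the functional $f\mapsto f(z)$, and $E'$ is the topological dual of $E$. $A(\mathbb{D})$ is the space of bounded holomorphic functions on $\mathbb{D}$ that are continuous on $\overline{\mathbb{D}}$ (that is, extend continuously to $\overline{\mathbb{D}}$; functions are identified with their extensions), with the supremum norm. $\mathrm{Lip}_\alpha(\mathbb{D})$ is the Banach space of functions $f$ analytic in $\mathbb{D}$ (and continuously extended to $\overline{\mathbb{D}}$) with $|f(z)-f(w)|=O(|z-w|^\alpha)$ for all $z,w\in\overline{\mathbb{D}}$.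 A weighted composition operator on such a space $E$ is an operator $C_{w,\varphi}f=w\cdot(f\circ\varphi)$ with $w:\overline{\mathbb{D}}\to\mathbb{C}$ and $\varphi:\overline{\mathbb{D}}\to\overline{\mathbb{D}}$ continuous, which is well defined and continuous from $E$ to $E$. An operator $T:E\to E$ is $\tau_p$-supercyclic if there is $f\in E$ such that $\{\lambda T^n f:\lambda\in\mathbb{C},\ n=0,1,2,\dots\}$ is dense in $E$ with respect to the topology induced by $\tau_p$. *)

theory Defs
  imports "HOL-Analysis.Analysis" "HOL-Complex_Analysis.Complex_Analysis"
    "HOL-Library.Function_Algebras"
begin

text \<open>
  A function on the closed unit disc is represented by the total function that agrees with it
  there and vanishes elsewhere. Representatives are unique, so equality of functions is equality
  on the disc, and the vector space operations are the pointwise ones.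
\<close>

abbreviation cdisc :: "complex set" where
  "cdisc \<equiv> cball 0 1"

abbreviation odisc :: "complex set" where
  "odisc \<equiv> ball 0 1"

definition cont_disc :: "(complex \<Rightarrow> complex) set" where
  "cont_disc = {f. continuous_on cdisc f \<and> (\<forall>z. z \<notin> cdisc \<longrightarrow> f z = 0)}"

text \<open>
  The library topology on a function type is the product topology. Members of
  \<open>cont_disc\<close> vanish off the disc, so the coordinates there impose no condition; see
  \<open>continuous_map_tau_p\<close> below.
\<close>

definition tau_p :: "(complex \<Rightarrow> complex) topology" where
  "tau_p = subtopology euclidean cont_disc"

definition fscale :: "complex \<Rightarrow> (complex \<Rightarrow> complex) \<Rightarrow> (complex \<Rightarrow> complex)" where
  "fscale c f = (\<lambda>z. c * f z)"

global_interpretation cfun: vector_space fscale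
  by unfold_locales (auto simp: fscale_def fun_eq_iff algebra_simps)

definition infinite_dimensional :: "(complex \<Rightarrow> complex) set \<Rightarrow> bool" where
  "infinite_dimensional E \<longleftrightarrow> \<not> (\<exists>B. finite B \<and> B \<subseteq> E \<and> cfun.span B = E)"

definition fconvex :: "(complex \<Rightarrow> complex) set \<Rightarrow> bool" where
  "fconvex V \<longleftrightarrow> (\<forall>f\<in>V. \<forall>g\<in>V. \<forall>t::real. 0 \<le> t \<and> t \<le> 1 \<longrightarrow>
      fscale (of_real (1 - t)) f + fscale (of_real t) g \<in> V)"

text \<open>
  No separation axiom is needed: a space continuously included in \<open>tau_p\<close> is Hausdorff.
\<close>

definition locally_convex_space :: "(complex \<Rightarrow> complex) set \<Rightarrow> (complex \<Rightarrow> complex) topology \<Rightarrow> bool" where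
  "locally_convex_space E T \<longleftrightarrow>
     cfun.subspace E \<and> topspace T = E \<and>
     continuous_map (prod_topology T T) T (\<lambda>(f, g). f + g) \<and>
     continuous_map (prod_topology euclidean T) T (\<lambda>(c, f). fscale c f) \<and>
     (\<forall>U. openin T U \<and> 0 \<in> U \<longrightarrow> (\<exists>V. openin T V \<and> fconvex V \<and> 0 \<in> V \<and> V \<subseteq> U))"

text \<open>
  Linear independence of the family of evaluation functionals on \<open>E\<close>, indexed by the points of
  the disc; in particular distinct points give distinct functionals.
\<close>

definition evaluations_independent :: "(complex \<Rightarrow> complex) set \<Rightarrow> bool" where
  "evaluations_independent E \<longleftrightarrow>
     (\<forall>F c. finite F \<and> F \<subseteq> cdisc \<and> (\<forall>f\<in>E. (\<Sum>z\<in>F. c z * f z) = 0) \<longrightarrow>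
        (\<forall>z\<in>F. c z = (0::complex)))"

definition wcomp :: "(complex \<Rightarrow> complex) \<Rightarrow> (complex \<Rightarrow> complex) \<Rightarrow> (complex \<Rightarrow> complex) \<Rightarrow> (complex \<Rightarrow> complex)" where
  "wcomp w \<phi> f = (\<lambda>z. if z \<in> cdisc then w z * f (\<phi> z) else 0)"

text \<open>
  That the operator is well defined on \<open>topspace T\<close>, i.e. maps it to itself, is part of
  \<open>continuous_map T T\<close>.
\<close>

definition weighted_comp_op :: "(complex \<Rightarrow> complex) topology \<Rightarrow> (complex \<Rightarrow> complex) \<Rightarrow> (complex \<Rightarrow> complex) \<Rightarrow> bool" where
  "weighted_comp_op T w \<phi> \<longleftrightarrow>
     w \<in> cont_disc \<and> \<phi> \<in> cont_disc \<and> \<phi> ` cdisc \<subseteq> cdisc \<and> continuous_map T T (wcomp w \<phi>)"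

definition tau_p_supercyclic :: "(complex \<Rightarrow> complex) set \<Rightarrow> ((complex \<Rightarrow> complex) \<Rightarrow> (complex \<Rightarrow> complex)) \<Rightarrow> bool" where
  "tau_p_supercyclic E S \<longleftrightarrow>
     (\<exists>f\<in>E. subtopology tau_p E closure_of {fscale c ((S ^^ n) f) | c n. True} = E)"

definition disc_algebra :: "(complex \<Rightarrow> complex) set" where
  "disc_algebra = {f \<in> cont_disc. f holomorphic_on odisc}"

definition sup_norm :: "(complex \<Rightarrow> complex) \<Rightarrow> real" where
  "sup_norm f = (SUP z\<in>cdisc. cmod (f z))"

definition lip_space :: "real \<Rightarrow> (complex \<Rightarrow> complex) set" where
  "lip_space \<alpha> = {f \<in> disc_algebra.
     \<exists>K. \<forall>z\<in>cdisc. \<forall>u\<in>cdisc. cmod (f z - f u) \<le> K * cmod (z - u) powr \<alpha>}"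

text \<open>The quotient is \<open>0\<close> on the diagonal, where it is a division by zero.\<close>

definition lip_norm :: "real \<Rightarrow> (complex \<Rightarrow> complex) \<Rightarrow> real" where
  "lip_norm \<alpha> f = sup_norm f +
     (SUP (z, u)\<in>cdisc \<times> cdisc. cmod (f z - f u) / cmod (z - u) powr \<alpha>)"

text \<open>
  The distance is cut off outside \<open>E\<close>, where the suprema above may be taken over unbounded
  sets, because \<open>Metric_space\<close> asks for nonnegativity on the whole type.
\<close>

definition norm_dist :: "(complex \<Rightarrow> complex) set \<Rightarrow> ((complex \<Rightarrow> complex) \<Rightarrow> real) \<Rightarrow> (complex \<Rightarrow> complex) \<Rightarrow> (complex \<Rightarrow> complex) \<Rightarrow> real" where
  "norm_dist E N f g = (if f \<in> E \<and> g \<in> E then N (f - g) else 0)"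

definition norm_topology :: "(complex \<Rightarrow> complex) set \<Rightarrow> ((complex \<Rightarrow> complex) \<Rightarrow> real) \<Rightarrow> (complex \<Rightarrow> complex) topology" where
  "norm_topology E N = Metric_space.mtopology E (norm_dist E N)"

lemma continuous_map_tau_p:
  "continuous_map X tau_p g \<longleftrightarrow>
     g \<in> topspace X \<rightarrow> cont_disc \<and> (\<forall>z\<in>cdisc. continuous_map X euclidean (\<lambda>x. g x z))"
proof -
  have eu: "(euclidean :: (complex \<Rightarrow> complex) topology) = product_topology (\<lambda>_. euclidean) UNIV"
    by (rule topology_eq[THEN iffD2]) (simp add: open_fun_def flip: open_openin)
  have "continuous_map X euclidean (\<lambda>x. g x z)"
    if "g \<in> topspace X \<rightarrow> cont_disc" "z \<notin> cdisc" for z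
  proof -
    have "continuous_map X euclidean (\<lambda>x. 0::complex)" by simp
    then show ?thesis
      by (rule continuous_map_eq) (use that in \<open>auto simp: cont_disc_def Pi_iff\<close>)
  qed
  then show ?thesis
    unfolding tau_p_def continuous_map_in_subtopology eu continuous_map_componentwise_UNIV
    by (auto simp: image_subset_iff_funcset)
qed

lemma bdd_above_sup_norm: "f \<in> cont_disc \<Longrightarrow> bdd_above ((\<lambda>z. cmod (f z)) ` cdisc)"
  unfolding cont_disc_def
  by (auto intro!: bounded_imp_bdd_above compact_imp_bounded compact_continuous_image continuous_intros)

lemma Metric_space_norm_dist:
  assumes sub: "cfun.subspace E"
    and pos: "\<And>f. f \<in> E \<Longrightarrow> 0 \<le> N f"
    and zero: "\<And>f. f \<in> E \<Longrightarrow> N f = 0 \<longleftrightarrow> f = 0"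
    and neg: "\<And>f. N (- f) = N f"
    and tri: "\<And>f g. f \<in> E \<Longrightarrow> g \<in> E \<Longrightarrow> N (f + g) \<le> N f + N g"
  shows "Metric_space E (norm_dist E N)"
proof
  fix f g h
  show "0 \<le> norm_dist E N f g"
    using pos cfun.subspace_diff[OF sub] by (auto simp: norm_dist_def)
  show "norm_dist E N f g = norm_dist E N g f"
    using neg[of "f - g"] by (auto simp: norm_dist_def)
  show "norm_dist E N f g = 0 \<longleftrightarrow> f = g" if "f \<in> E" "g \<in> E"
    using that zero[OF cfun.subspace_diff[OF sub that]] by (auto simp: norm_dist_def)
  show "norm_dist E N f h \<le> norm_dist E N f g + norm_dist E N g h"
    if "f \<in> E" "g \<in> E" "h \<in> E"
    using that tri[of "f - g" "g - h"] cfun.subspace_diff[OF sub] by (auto simp: norm_dist_def)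
qed

lemma subspace_disc_algebra: "cfun.subspace disc_algebra"
  unfolding cfun.subspace_def disc_algebra_def cont_disc_def fscale_def plus_fun_def zero_fun_def
  by (auto intro!: continuous_intros holomorphic_intros)

lemma sup_norm_nonneg: "f \<in> cont_disc \<Longrightarrow> 0 \<le> sup_norm f"
  unfolding sup_norm_def by (rule cSUP_upper2[OF bdd_above_sup_norm, of _ 0]) auto

lemma sup_norm_eq_0: "f \<in> cont_disc \<Longrightarrow> sup_norm f = 0 \<longleftrightarrow> f = 0"
proof
  assume f: "f \<in> cont_disc" and s: "sup_norm f = 0"
  have "cmod (f z) \<le> 0" if "z \<in> cdisc" for z
    using cSUP_upper[OF that bdd_above_sup_norm[OF f]] s by (simp add: sup_norm_def)
  then show "f = 0" using f by (fastforce simp: cont_disc_def fun_eq_iff)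
qed (simp add: sup_norm_def)

lemma sup_norm_triangle:
  assumes "f \<in> cont_disc" "g \<in> cont_disc"
  shows "sup_norm (f + g) \<le> sup_norm f + sup_norm g"
  unfolding sup_norm_def
proof (rule cSUP_least)
  fix z assume z: "z \<in> cdisc"
  show "cmod ((f + g) z) \<le> (SUP z\<in>cdisc. cmod (f z)) + (SUP z\<in>cdisc. cmod (g z))"
    using cSUP_upper[OF z bdd_above_sup_norm[OF assms(1)]]
      cSUP_upper[OF z bdd_above_sup_norm[OF assms(2)]] norm_triangle_ineq[of "f z" "g z"] by simp
qed auto

lemma disc_algebra_cont: "f \<in> disc_algebra \<Longrightarrow> f \<in> cont_disc"
  by (simp add: disc_algebra_def)

lemma Metric_space_disc_algebra: "Metric_space disc_algebra (norm_dist disc_algebra sup_norm)"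
  by (intro Metric_space_norm_dist subspace_disc_algebra sup_norm_nonneg sup_norm_eq_0
      sup_norm_triangle disc_algebra_cont) (auto simp: sup_norm_def)

lemma lip_space_disc_algebra: "f \<in> lip_space \<alpha> \<Longrightarrow> f \<in> disc_algebra"
  by (simp add: lip_space_def)

lemma subspace_lip_space: "cfun.subspace (lip_space \<alpha>)"
  unfolding cfun.subspace_def
proof (intro conjI ballI allI)
  show "0 \<in> lip_space \<alpha>"
    using cfun.subspace_0[OF subspace_disc_algebra] by (auto simp: lip_space_def intro!: exI[of _ 0])
next
  fix f g assume "f \<in> lip_space \<alpha>" "g \<in> lip_space \<alpha>"
  then obtain K L where fg: "f \<in> disc_algebra" "g \<in> disc_algebra"
    and K: "\<And>z u. z \<in> cdisc \<Longrightarrow> u \<in> cdisc \<Longrightarrow> cmod (f z - f u) \<le> K * cmod (z - u) powr \<alpha>"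
    and L: "\<And>z u. z \<in> cdisc \<Longrightarrow> u \<in> cdisc \<Longrightarrow> cmod (g z - g u) \<le> L * cmod (z - u) powr \<alpha>"
    unfolding lip_space_def by blast
  have "cmod ((f + g) z - (f + g) u) \<le> (K + L) * cmod (z - u) powr \<alpha>"
    if "z \<in> cdisc" "u \<in> cdisc" for z u
    using K[OF that] L[OF that] norm_triangle_ineq[of "f z - f u" "g z - g u"]
    by (simp add: algebra_simps)
  then show "f + g \<in> lip_space \<alpha>"
    using cfun.subspace_add[OF subspace_disc_algebra fg] unfolding lip_space_def by blast
next
  fix c f assume "f \<in> lip_space \<alpha>"
  then obtain K where f: "f \<in> disc_algebra"
    and K: "\<And>z u. z \<in> cdisc \<Longrightarrow> u \<in> cdisc \<Longrightarrow> cmod (f z - f u) \<le> K * cmod (z - u) powr \<alpha>"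
    unfolding lip_space_def by blast
  have "cmod (fscale c f z - fscale c f u) \<le> (cmod c * K) * cmod (z - u) powr \<alpha>"
    if "z \<in> cdisc" "u \<in> cdisc" for z u
    using mult_left_mono[OF K[OF that], of "cmod c"]
    by (simp add: fscale_def mult.assoc norm_mult flip: right_diff_distrib)
  then show "fscale c f \<in> lip_space \<alpha>"
    using cfun.subspace_scale[OF subspace_disc_algebra f] unfolding lip_space_def by blast
qed

lemma bdd_above_lip:
  assumes "f \<in> lip_space \<alpha>"
  shows "bdd_above ((\<lambda>(z, u). cmod (f z - f u) / cmod (z - u) powr \<alpha>) ` (cdisc \<times> cdisc))"
proof -
  obtain K where K: "\<And>z u. z \<in> cdisc \<Longrightarrow> u \<in> cdisc \<Longrightarrow> cmod (f z - f u) \<le> K * cmod (z - u) powr \<alpha>"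
    using assms unfolding lip_space_def by blast
  have "cmod (f z - f u) / cmod (z - u) powr \<alpha> \<le> max K 0" if "z \<in> cdisc" "u \<in> cdisc" for z u
  proof (cases "z = u")
    case False
    then have "cmod (f z - f u) / cmod (z - u) powr \<alpha> \<le> K"
      using K[OF that] by (simp add: pos_divide_le_eq)
    then show ?thesis by simp
  qed simp
  then show ?thesis by (intro bdd_aboveI[of _ "max K 0"]) auto
qed

lemma Metric_space_lip_space: "Metric_space (lip_space \<alpha>) (norm_dist (lip_space \<alpha>) (lip_norm \<alpha>))"
proof -
  define p where "p f = (SUP (z, u)\<in>cdisc \<times> cdisc. cmod (f z - f u) / cmod (z - u) powr \<alpha>)"
    for f :: "complex \<Rightarrow> complex"
  have N: "lip_norm \<alpha> f = sup_norm f + p f" for f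
    by (simp add: lip_norm_def p_def)
  have cont: "f \<in> cont_disc" if "f \<in> lip_space \<alpha>" for f
    using that by (simp add: lip_space_def disc_algebra_def)
  have le: "cmod (f z - f u) / cmod (z - u) powr \<alpha> \<le> p f"
    if "f \<in> lip_space \<alpha>" "z \<in> cdisc" "u \<in> cdisc" for f z u
    using cSUP_upper[OF _ bdd_above_lip[OF that(1)], of "(z, u)"] that by (simp add: p_def)
  have p0: "0 \<le> p f" if "f \<in> lip_space \<alpha>" for f
    using le[OF that, of 0 0] by simp
  have pt: "p (f + g) \<le> p f + p g" if "f \<in> lip_space \<alpha>" "g \<in> lip_space \<alpha>" for f g
  proof -
    have "cmod ((f + g) z - (f + g) u) / cmod (z - u) powr \<alpha> \<le> p f + p g"
      if zu: "z \<in> cdisc" "u \<in> cdisc" for z u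
    proof -
      have "cmod ((f + g) z - (f + g) u) / cmod (z - u) powr \<alpha>
          \<le> (cmod (f z - f u) + cmod (g z - g u)) / cmod (z - u) powr \<alpha>"
        using norm_triangle_ineq[of "f z - f u" "g z - g u"]
        by (intro divide_right_mono) (simp_all add: algebra_simps)
      also have "\<dots> \<le> p f + p g"
        using le[OF \<open>f \<in> _\<close> zu] le[OF \<open>g \<in> _\<close> zu] by (simp add: add_divide_distrib)
      finally show ?thesis .
    qed
    then show ?thesis
      unfolding p_def[of "f + g"] by (intro cSUP_least) auto
  qed
  have pm: "p (- f) = p f" for f
  proof -
    have "cmod ((- f) z - (- f) u) = cmod (f z - f u)" for z u
      using norm_minus_commute[of "f z" "f u"] by simp
    then show ?thesis unfolding p_def by presburger
  qed
  have pz: "p 0 = 0" by (simp add: p_def case_prod_unfold)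
  show ?thesis
  proof (rule Metric_space_norm_dist[OF subspace_lip_space])
    fix f assume f: "f \<in> lip_space \<alpha>"
    show "0 \<le> lip_norm \<alpha> f"
      using sup_norm_nonneg[OF cont[OF f]] p0[OF f] by (simp add: N)
    show "lip_norm \<alpha> f = 0 \<longleftrightarrow> f = 0"
      using sup_norm_nonneg[OF cont[OF f]] p0[OF f] sup_norm_eq_0[OF cont[OF f]] pz
      by (auto simp: N)
  next
    fix f show "lip_norm \<alpha> (- f) = lip_norm \<alpha> f"
      by (simp add: N pm) (simp add: sup_norm_def)
  next
    fix f g assume fg: "f \<in> lip_space \<alpha>" "g \<in> lip_space \<alpha>"
    show "lip_norm \<alpha> (f + g) \<le> lip_norm \<alpha> f + lip_norm \<alpha> g"
      using sup_norm_triangle[OF cont[OF fg(1)] cont[OF fg(2)]] pt[OF fg] by (simp add: N)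
  qed
qed

end

theory Submission
  imports Defs
begin

text \<open>
  Suppose that \<open>f\<close> is a supercyclic vector of \<open>T = C\<^sub>w\<^sub>,\<^sub>\<phi>\<close>. Since any two distinct evaluations map
  \<open>E\<close> onto \<open>\<complex>\<^sup>2\<close>, no inequality \<open>\<bar>T\<^sup>n f(u)\<bar> \<le> K \<bar>T\<^sup>n f(v)\<bar>\<close> with \<open>u \<noteq> v\<close> can hold for all \<open>n\<close>. This forces \<open>w\<close>
  to have no zeros, \<open>f\<close> not to vanish at fixed points of \<open>\<phi>\<close>, and \<open>\<phi>\<close> to have at most one fixed
  point, because on two fixed points the quotient of the values of \<open>T\<^sup>n f\<close> is geometric in \<open>n\<close>.
  By Brouwer's theorem and the Schwarz-Pick lemma for \<open>r\<phi>\<close>, \<open>r \<rightarrow> 1\<close>, as in Wolff's lemma, \<open>\<phi>\<close> has a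
  fixed point \<open>p\<close> in the closed disc with arbitrarily small invariant neighbourhoods (pseudohyperbolic
  discs or horodiscs). On a small one, \<open>f\<close> is bounded away from \<open>0\<close>, so for \<open>z \<noteq> p\<close> in it \<open>T\<^sup>n f(\<phi>(z))\<close>
  is dominated by \<open>T\<^sup>n f(z)\<close>, which is impossible.

  On \<open>A(\<D>)\<close> and the Lipschitz spaces, \<open>\<phi>\<close> is only assumed continuous; as \<open>w\<close> has no zeros, it is
  holomorphic, being the quotient of the images of the identity and of the constant \<open>1\<close>.
\<close>

section \<open>Invariant discs and horodiscs\<close>

text \<open>Splits the denominator of the pseudohyperbolic distance from \<open>z\<close> to
  \<open>a\<close>, so that this distance becomes a function of the quotient of
  \<open>(cmod (z - a))\<^sup>2\<close> by \<open>1 - (cmod z)\<^sup>2\<close>.\<close>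

lemma cmod_one_minus_cnj_mult:
  "(cmod (1 - cnj a * z))\<^sup>2 = (cmod (z - a))\<^sup>2 + (1 - (cmod a)\<^sup>2) * (1 - (cmod z)\<^sup>2)"
  unfolding cmod_power2 by (simp add: power2_eq_square) (simp add: algebra_simps)

text \<open>Conjugation by the Moebius map taking \<open>a\<close> to \<open>0\<close> and the
  Schwarz lemma show that \<open>\<psi>\<close> does not increase the pseudohyperbolic distance to
  \<open>a\<close>. Cleared of denominators and of the factor \<open>1 - (cmod a)\<^sup>2\<close>,
  the inequality keeps its content when \<open>a\<close> tends to the unit circle.\<close>

lemma Schwarz_Pick_fixed_point:
  assumes hol: "\<psi> holomorphic_on ball 0 1" and maps: "\<psi> ` ball 0 1 \<subseteq> ball 0 1"
    and a: "cmod a < 1" "\<psi> a = a" and z: "cmod z < 1"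
  shows "(cmod (\<psi> z - a))\<^sup>2 * (1 - (cmod z)\<^sup>2) \<le> (cmod (z - a))\<^sup>2 * (1 - (cmod (\<psi> z))\<^sup>2)"
proof -
  define m where "m = Moebius_function 0"
  have \<psi>1: "cmod (\<psi> u) < 1" if "cmod u < 1" for u
    using that maps by (force simp: image_subset_iff)
  have m1: "cmod (m b u) < 1" if "cmod b < 1" "cmod u < 1" for b u
    unfolding m_def using that by (rule Moebius_function_norm_lt_1)
  have mhol: "m b holomorphic_on ball 0 1" if "cmod b < 1" for b
    unfolding m_def using that by (rule Moebius_function_holomorphic)
  define g where "g = m a \<circ> \<psi> \<circ> m (- a)"
  have ghol: "g holomorphic_on ball 0 1"
    unfolding g_def
    by (intro holomorphic_on_compose_gen[where t = "ball 0 1"] mhol hol)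
      (use a maps m1 in auto)
  have m0: "m (- a) 0 = a" by (simp add: m_def Moebius_function_of_zero)
  have g0: "g 0 = 0"
    using a by (simp add: g_def m0) (simp add: m_def Moebius_function_eq_zero)
  have g1: "cmod (g u) < 1" if "cmod u < 1" for u
    using that a by (simp add: g_def m1 \<psi>1)
  have "cmod (g (m a z)) \<le> cmod (m a z)"
    by (rule Schwarz_Lemma(1)[OF ghol g0 g1 m1[OF a(1) z]])
  moreover have "m (- a) (m a z) = z"
    unfolding m_def using a z by (intro Moebius_function_compose) auto
  ultimately have "cmod (m a (\<psi> z)) \<le> cmod (m a z)" by (simp add: g_def)
  then have le: "(cmod (m a (\<psi> z)))\<^sup>2 \<le> (cmod (m a z))\<^sup>2" by (intro power_mono) auto
  have pos: "0 < 1 - (cmod u)\<^sup>2" if "cmod u < 1" for u :: complex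
    using that by (simp add: power_less_one_iff)
  define k where "k = 1 - (cmod a)\<^sup>2"
  define X where "X = (cmod (\<psi> z - a))\<^sup>2"
  define Y where "Y = 1 - (cmod (\<psi> z))\<^sup>2"
  define X' where "X' = (cmod (z - a))\<^sup>2"
  define Y' where "Y' = 1 - (cmod z)\<^sup>2"
  have P: "0 < k" "0 < Y" "0 < Y'" "0 \<le> X" "0 \<le> X'"
    using pos a z \<psi>1 by (auto simp: k_def X_def Y_def X'_def Y'_def)
  have "X / (X + k * Y) \<le> X' / (X' + k * Y')"
    using le unfolding m_def Moebius_function_simple norm_divide power_divide
      cmod_one_minus_cnj_mult by (simp add: k_def X_def Y_def X'_def Y'_def)
  moreover have "0 < X + k * Y" "0 < X' + k * Y'" using P by (auto intro: add_nonneg_pos)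
  ultimately have "X * (X' + k * Y') \<le> X' * (X + k * Y)"
    by (simp add: divide_simps mult.commute)
  then have "k * (X * Y') \<le> k * (X' * Y)" by (simp add: algebra_simps)
  then show ?thesis using P by (simp add: X_def Y_def X'_def Y'_def)
qed

text \<open>The inequality is inherited from maps \<open>r n * \<phi>\<close> whose fixed points
  converge to \<open>p\<close> along a subsequence. It makes the pseudohyperbolic discs about
  \<open>p\<close>, or the horodiscs at \<open>p\<close> if \<open>cmod p = 1\<close>,
  invariant.\<close>

lemma disc_algebra_Wolff:
  assumes \<phi>: "\<phi> \<in> disc_algebra" "\<phi> ` cdisc \<subseteq> cdisc"
  obtains p where "p \<in> cdisc" "\<phi> p = p"
    "\<And>z. z \<in> cdisc \<Longrightarrow>
      (cmod (\<phi> z - p))\<^sup>2 * (1 - (cmod z)\<^sup>2) \<le> (cmod (z - p))\<^sup>2 * (1 - (cmod (\<phi> z))\<^sup>2)"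
proof -
  have cont: "continuous_on cdisc \<phi>" and hol: "\<phi> holomorphic_on odisc"
    using \<phi> by (auto simp: disc_algebra_def cont_disc_def)
  have \<phi>1: "cmod (\<phi> z) \<le> 1" if "cmod z \<le> 1" for z
    using that \<phi>(2) by (force simp: image_subset_iff)
  \<comment> \<open>As \<open>r n < 1\<close>, the scaled map sends the closed disc into the open
    one, so its Brouwer fixed point is interior and \<open>Schwarz_Pick_fixed_point\<close>
    applies.\<close>
  define r where "r n = real n / (1 + real n)" for n
  have r: "0 \<le> r n" "r n < 1" for n by (auto simp: r_def)
  have r_lim: "r \<longlonglongrightarrow> 1"
    unfolding r_def by (rule LIMSEQ_n_over_Suc_n[unfolded of_nat_Suc])
  have r_bound: "cmod (of_real (r n) * \<phi> z) < 1" if "cmod z \<le> 1" for n z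
  proof -
    have "r n * cmod (\<phi> z) \<le> r n" using \<phi>1[OF that] r[of n] by (simp add: mult_left_le)
    then show ?thesis using r[of n] by (simp add: norm_mult)
  qed
  have "\<exists>a. cmod a \<le> 1 \<and> of_real (r n) * \<phi> a = a" for n
  proof -
    have "continuous_on cdisc (\<lambda>z. of_real (r n) * \<phi> z)"
      by (intro continuous_intros cont)
    moreover have "(\<lambda>z. of_real (r n) * \<phi> z) \<in> cdisc \<rightarrow> cdisc"
      using r_bound[of _ n] by (auto simp: less_imp_le)
    ultimately show ?thesis
      using brouwer_ball[of 1 0 "\<lambda>z. of_real (r n) * \<phi> z"] by auto
  qed
  then obtain a where a: "\<And>n. cmod (a n) \<le> 1" "\<And>n. of_real (r n) * \<phi> (a n) = a n"
    by metis
  obtain p s where p: "p \<in> cdisc" and s: "strict_mono s" "(a \<circ> s) \<longlonglongrightarrow> p"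
    using compact_imp_seq_compact[OF compact_cball, of 0 1] a(1)
    by (auto elim!: seq_compactE[of _ a])
  have rs: "(\<lambda>n. r (s n)) \<longlonglongrightarrow> 1"
    using LIMSEQ_subseq_LIMSEQ[OF r_lim s(1)] by (simp add: o_def)
  have as: "(\<lambda>n. a (s n)) \<longlonglongrightarrow> p" using s(2) by (simp add: o_def)
  have "(\<lambda>n. of_real (r (s n)) * \<phi> (a (s n))) \<longlonglongrightarrow> of_real 1 * \<phi> p"
    using a by (intro tendsto_intros rs continuous_on_tendsto_compose[OF cont as p]) auto
  then have "(\<lambda>n. a (s n)) \<longlonglongrightarrow> \<phi> p" by (simp add: a)
  then have fixed: "\<phi> p = p" using as by (rule LIMSEQ_unique)
  have "(cmod (\<phi> z - p))\<^sup>2 * (1 - (cmod z)\<^sup>2) \<le> (cmod (z - p))\<^sup>2 * (1 - (cmod (\<phi> z))\<^sup>2)"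
    if z: "z \<in> cdisc" for z
  proof (cases "cmod z < 1")
    case True
    define q where "q n = of_real (r (s n)) * \<phi> z" for n
    have q: "q \<longlonglongrightarrow> of_real 1 * \<phi> z" unfolding q_def by (intro tendsto_intros rs)
    have le: "(cmod (q n - a (s n)))\<^sup>2 * (1 - (cmod z)\<^sup>2) \<le> (cmod (z - a (s n)))\<^sup>2 * (1 - (cmod (q n))\<^sup>2)"
      for n
      unfolding q_def
    proof (rule Schwarz_Pick_fixed_point[where \<psi> = "\<lambda>z. of_real (r (s n)) * \<phi> z"])
      show "(\<lambda>z. of_real (r (s n)) * \<phi> z) holomorphic_on odisc"
        by (intro holomorphic_intros hol)
      show "(\<lambda>z. of_real (r (s n)) * \<phi> z) ` odisc \<subseteq> odisc"
        using r_bound by (force simp: image_subset_iff)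
      show "of_real (r (s n)) * \<phi> (a (s n)) = a (s n)" by (rule a(2))
      show "cmod (a (s n)) < 1" using r_bound[OF a(1), of "s n" "s n"] a(2)[of "s n"] by simp
    qed (rule True)
    have l1: "(\<lambda>n. (cmod (q n - a (s n)))\<^sup>2 * (1 - (cmod z)\<^sup>2))
        \<longlonglongrightarrow> (cmod (of_real 1 * \<phi> z - p))\<^sup>2 * (1 - (cmod z)\<^sup>2)"
      by (intro tendsto_intros q as)
    have l2: "(\<lambda>n. (cmod (z - a (s n)))\<^sup>2 * (1 - (cmod (q n))\<^sup>2))
        \<longlonglongrightarrow> (cmod (z - p))\<^sup>2 * (1 - (cmod (of_real 1 * \<phi> z))\<^sup>2)"
      by (intro tendsto_intros q as)
    show ?thesis using LIMSEQ_le[OF l1 l2] le by simp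
  next
    \<comment> \<open>On the unit circle the left side vanishes and the right side is
      nonnegative.\<close>
    case False
    then have "cmod z = 1" using z by simp
    then show ?thesis using \<phi>1[of z] by (simp add: power_le_one)
  qed
  then show ?thesis using that p fixed by blast
qed

lemma ex_invariant_subset_near_fixed_point:
  assumes \<phi>: "\<phi> \<in> disc_algebra" "\<phi> ` cdisc \<subseteq> cdisc"
  obtains p where "p \<in> cdisc" "\<phi> p = p"
    "\<And>\<epsilon>. 0 < \<epsilon> \<Longrightarrow> \<exists>V \<subseteq> cdisc \<inter> cball p \<epsilon>. \<phi> ` V \<subseteq> V \<and> (\<exists>z\<in>V. z \<noteq> p)"
proof -
  obtain p where p: "p \<in> cdisc" "\<phi> p = p" and W: "\<And>z. z \<in> cdisc \<Longrightarrow>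
      (cmod (\<phi> z - p))\<^sup>2 * (1 - (cmod z)\<^sup>2) \<le> (cmod (z - p))\<^sup>2 * (1 - (cmod (\<phi> z))\<^sup>2)"
    using disc_algebra_Wolff[OF \<phi>] by blast
  have "\<exists>V \<subseteq> cdisc \<inter> cball p \<epsilon>. \<phi> ` V \<subseteq> V \<and> (\<exists>z\<in>V. z \<noteq> p)" if \<epsilon>: "0 < \<epsilon>" for \<epsilon>
  proof -
    \<comment> \<open>Since \<open>1 - (cmod z)\<^sup>2 \<le> 1\<close>, this level keeps
      \<open>V\<close> within distance \<open>\<epsilon>\<close> of \<open>p\<close>.\<close>
    define c where "c = \<epsilon>\<^sup>2"
    have c: "0 < c" using \<epsilon> by (simp add: c_def)
    define V where "V = {z \<in> cdisc. (cmod (z - p))\<^sup>2 \<le> c * (1 - (cmod z)\<^sup>2)}"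
    have sub: "V \<subseteq> cdisc \<inter> cball p \<epsilon>"
    proof
      fix z assume z: "z \<in> V"
      then have "(cmod (z - p))\<^sup>2 \<le> c * (1 - (cmod z)\<^sup>2)" by (simp add: V_def)
      also have "\<dots> \<le> c" using c by simp
      finally have "dist p z \<le> \<epsilon>"
        unfolding c_def dist_norm norm_minus_commute[of p] by (rule power2_le_imp_le) (use \<epsilon> in simp)
      then show "z \<in> cdisc \<inter> cball p \<epsilon>" using z by (simp add: V_def)
    qed
    have "\<phi> z \<in> V" if z: "z \<in> V" for z
    proof (cases "cmod z < 1")
      case True
      then have pos: "0 < 1 - (cmod z)\<^sup>2" by (simp add: power_less_one_iff)
      have zc: "z \<in> cdisc" and le: "(cmod (z - p))\<^sup>2 \<le> c * (1 - (cmod z)\<^sup>2)"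
        using z by (auto simp: V_def)
      have \<phi>z: "\<phi> z \<in> cdisc" using \<phi> zc by blast
      then have "0 \<le> 1 - (cmod (\<phi> z))\<^sup>2" by (simp add: power_le_one)
      from order.trans[OF W[OF zc] mult_right_mono[OF le this]]
      have "(1 - (cmod z)\<^sup>2) * (cmod (\<phi> z - p))\<^sup>2 \<le> (1 - (cmod z)\<^sup>2) * (c * (1 - (cmod (\<phi> z))\<^sup>2))"
        by (simp add: mult_ac)
      then show ?thesis using pos \<phi>z by (simp add: V_def)
    next
      \<comment> \<open>On the unit circle the inequality defining \<open>V\<close> leaves only
        \<open>z = p\<close>.\<close>
      case False
      then have "z = p" using z by (auto simp: V_def)
      then show ?thesis using p z by simp
    qed
    moreover have "\<exists>z\<in>V. z \<noteq> p"
    proof -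
      \<comment> \<open>The witness is \<open>t\<close> itself if \<open>p = 0\<close>, and
        otherwise the point \<open>(1 - t) * p\<close> on the radius to \<open>p\<close>. The first
        two bounds give \<open>t\<^sup>2 \<le> c * (1 - t\<^sup>2)\<close> for the former;
        \<open>t \<le> c\<close> serves the latter.\<close>
      define t where "t = min (1/2) (min (\<epsilon> / 2) c)"
      have t: "0 < t" "t \<le> 1/2" "t \<le> \<epsilon> / 2" "t \<le> c" using c \<epsilon> by (auto simp: t_def)
      show ?thesis
      proof (cases "p = 0")
        case True
        have "t\<^sup>2 \<le> (\<epsilon> / 2)\<^sup>2" "t\<^sup>2 \<le> (1/2)\<^sup>2" using t by (auto intro!: power_mono)
        then have "t\<^sup>2 \<le> c / 4" "t\<^sup>2 \<le> 1/4" by (auto simp: c_def power_divide)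
        moreover from this have "c * t\<^sup>2 \<le> c * (1/4)" using c by (intro mult_left_mono) auto
        ultimately have "t\<^sup>2 \<le> c - c * t\<^sup>2" using c by linarith
        then have "of_real t \<in> V"
          using t True by (simp add: V_def right_diff_distrib)
        then show ?thesis using True t by (intro bexI[of _ "of_real t"]) auto
      next
        case False
        define z where "z = of_real (1 - t) * p"
        have p1: "(cmod p)\<^sup>2 \<le> 1" using p by (simp add: power_le_one)
        have nz: "cmod z = (1 - t) * cmod p"
          unfolding z_def norm_mult norm_of_real using t by simp
        have zp: "z - p = of_real (- t) * p" by (simp add: z_def algebra_simps)
        have "(cmod (z - p))\<^sup>2 = t\<^sup>2 * (cmod p)\<^sup>2" by (simp add: zp norm_mult power_mult_distrib)
        also have "\<dots> \<le> t * t" using p1 by (simp add: power2_eq_square[of t] mult_left_le)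
        also have "\<dots> \<le> c * t" using t by simp
        also have "\<dots> \<le> c * (1 - (1 - t)\<^sup>2)"
          using t c by (simp add: power2_eq_square algebra_simps)
        also have "\<dots> \<le> c * (1 - (1 - t)\<^sup>2 * (cmod p)\<^sup>2)"
          using c p1 by (simp add: mult_left_le)
        also have "(1 - t)\<^sup>2 * (cmod p)\<^sup>2 = (cmod z)\<^sup>2"
          by (simp add: nz power_mult_distrib)
        finally have "(cmod (z - p))\<^sup>2 \<le> c * (1 - (cmod z)\<^sup>2)" .
        moreover have "cmod z \<le> 1"
          using t p by (simp add: nz mult_le_one)
        ultimately have "z \<in> V" by (simp add: V_def)
        moreover have "z \<noteq> p" using zp False t by auto
        ultimately show ?thesis by blast
      qed
    qed
    ultimately show ?thesis using sub by blast
  qed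
  then show ?thesis using that p by blast
qed

section \<open>Supercyclic vectors\<close>

text \<open>The common input of all three cases: an abstract \<open>E\<close> gets it from
  independent evaluations, the concrete spaces from affine functions.\<close>

definition interpolates_pairs :: "(complex \<Rightarrow> complex) set \<Rightarrow> bool" where
  "interpolates_pairs E \<longleftrightarrow>
     (\<forall>u\<in>cdisc. \<forall>v\<in>cdisc. u \<noteq> v \<longrightarrow> (\<forall>a b. \<exists>g\<in>E. g u = a \<and> g v = b))"

lemma interpolates_pairsD:
  "interpolates_pairs E \<Longrightarrow> u \<in> cdisc \<Longrightarrow> v \<in> cdisc \<Longrightarrow> u \<noteq> v \<Longrightarrow> \<exists>g\<in>E. g u = a \<and> g v = b"
  by (simp add: interpolates_pairs_def)

lemma evaluations_independent_interpolates_pairs: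
  assumes sub: "cfun.subspace E" and ind: "evaluations_independent E"
  shows "interpolates_pairs E"
  unfolding interpolates_pairs_def
proof (intro ballI impI allI)
  fix u v a b assume uv: "u \<in> cdisc" "v \<in> cdisc" "u \<noteq> v"
  have ex: "\<exists>g\<in>E. s * g u + t * g v \<noteq> 0" if "s \<noteq> 0 \<or> t \<noteq> 0" for s t
  proof (rule ccontr)
    assume "\<not> ?thesis"
    then have "\<forall>x\<in>{u, v}. (if x = u then s else t) = 0"
      using uv ind[unfolded evaluations_independent_def, THEN spec, THEN spec,
          of "{u, v}" "\<lambda>x. if x = u then s else t"] by auto
    then show False using that uv by auto
  qed
  \<comment> \<open>Cramer's rule: \<open>g\<close> is not killed by the evaluation at
    \<open>u\<close>, and \<open>h\<close> is chosen to make the determinant \<open>d\<close> of the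
    values of \<open>g\<close> and \<open>h\<close> at \<open>u\<close> and \<open>v\<close>
    nonzero; \<open>k\<close> solves the system.\<close>
  obtain g where g: "g \<in> E" "g u \<noteq> 0" using ex[of 1 0] by auto
  obtain h where h: "h \<in> E" "g v * h u - g u * h v \<noteq> 0" using ex[of "g v" "- g u"] g by auto
  define d where "d = g v * h u - g u * h v"
  define k where "k = fscale ((b * h u - a * h v) / d) g + fscale ((a * g v - b * g u) / d) h"
  have d: "d \<noteq> 0" using h by (simp add: d_def)
  have "k u = a * d / d" "k v = b * d / d"
    by (simp_all only: k_def fscale_def plus_fun_apply times_divide_eq_left
        add_divide_distrib[symmetric] d_def) (simp_all add: algebra_simps)
  moreover have "k \<in> E"
    unfolding k_def using g h by (intro cfun.subspace_add cfun.subspace_scale sub)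
  ultimately show "\<exists>g\<in>E. g u = a \<and> g v = b" using d by auto
qed

locale supercyclic_vector =
  fixes E :: "(complex \<Rightarrow> complex) set" and S :: "(complex \<Rightarrow> complex) \<Rightarrow> complex \<Rightarrow> complex"
    and f :: "complex \<Rightarrow> complex"
  assumes interp: "interpolates_pairs E"
    and closure: "subtopology tau_p E closure_of {fscale c ((S ^^ n) f) | c n. True} = E"
begin

text \<open>Evaluation at the pair \<open>u\<close>, \<open>v\<close> is continuous for pointwise
  convergence. If it sent the projective orbit into \<open>C\<close>, it would send its closure
  \<open>E\<close> there too, but some member of \<open>E\<close> takes the values \<open>a\<close>,
  \<open>b\<close>.\<close>

lemma orbit_leaves_closed_set:
  assumes uv: "u \<in> cdisc" "v \<in> cdisc" "u \<noteq> v"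
    and C: "closed C" "(a, b) \<notin> C"
  obtains c n where "(c * (S ^^ n) f u, c * (S ^^ n) f v) \<notin> C"
proof -
  obtain g where g: "g \<in> E" "g u = a" "g v = b" using interpolates_pairsD[OF interp uv] by blast
  let ?X = "subtopology tau_p E" and ?O = "{fscale c ((S ^^ n) f) | c n. True}"
  define D where "D = (\<lambda>h :: complex \<Rightarrow> complex. (h u, h v)) -` C"
  have "continuous_on UNIV (\<lambda>h :: complex \<Rightarrow> complex. (h u, h v))"
    by (intro continuous_intros continuous_on_product_coordinates)
  then have "closed D" unfolding D_def using C by (intro closed_vimage) auto
  then have closedin: "closedin ?X (topspace ?X \<inter> D)"
    unfolding tau_p_def subtopology_subtopology topspace_subtopology
    by (simp add: closedin_closed_Int)
  have "\<not> ?O \<subseteq> D"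
  proof
    assume "?O \<subseteq> D"
    then have "topspace ?X \<inter> ?O \<subseteq> topspace ?X \<inter> D" by blast
    then have "?X closure_of ?O \<subseteq> topspace ?X \<inter> D"
      using closedin unfolding closure_of_restrict[of ?X ?O] by (rule closure_of_minimal)
    then have "g \<in> D" using closure g by blast
    then show False using g C by (simp add: D_def)
  qed
  then obtain c n where "fscale c ((S ^^ n) f) \<notin> D" by blast
  then show ?thesis by (intro that[of c n]) (simp add: D_def fscale_def)
qed

lemma not_dominated:
  assumes uv: "u \<in> cdisc" "v \<in> cdisc" "u \<noteq> v"
  obtains n where "K * cmod ((S ^^ n) f v) < cmod ((S ^^ n) f u)"
proof -
  have norm_K: "cmod (of_real (\<bar>K\<bar> + 1)) = \<bar>K\<bar> + 1"
    unfolding norm_of_real by simp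
  \<comment> \<open>A closed cone, so the scalar \<open>c\<close> cancels below. It misses
    \<open>(\<bar>K\<bar> + 1, 1)\<close> for negative \<open>K\<close> too.\<close>
  define C where "C = {x. cmod (fst x) \<le> K * cmod (snd x)}"
  have "closed C"
    unfolding C_def by (intro closed_Collect_le continuous_intros)
  moreover have "(of_real (\<bar>K\<bar> + 1), 1) \<notin> C"
    using norm_K by (simp add: C_def del: of_real_add)
  ultimately obtain c n where "(c * (S ^^ n) f u, c * (S ^^ n) f v) \<notin> C"
    using orbit_leaves_closed_set[OF uv] by blast
  then have "cmod c * (K * cmod ((S ^^ n) f v)) < cmod c * cmod ((S ^^ n) f u)"
    by (simp add: C_def norm_mult mult_ac)
  then show ?thesis by (rule that[OF mult_left_less_imp_less[OF _ norm_ge_zero]])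
qed

end

section \<open>Orbits of weighted composition operators\<close>

lemma wcomp_funpow:
  assumes "\<phi> ` cdisc \<subseteq> cdisc" "z \<in> cdisc"
  shows "(wcomp w \<phi> ^^ n) f z = (\<Prod>j<n. w ((\<phi> ^^ j) z)) * f ((\<phi> ^^ n) z)"
  using assms(2)
proof (induction n arbitrary: z)
  case (Suc n)
  have "\<phi> z \<in> cdisc" using assms(1) Suc.prems by blast
  moreover have "(\<Prod>j<Suc n. w ((\<phi> ^^ j) z)) = w z * (\<Prod>j<n. w ((\<phi> ^^ j) (\<phi> z)))"
    by (simp add: prod.lessThan_Suc_shift funpow_swap1 del: prod.lessThan_Suc)
  ultimately show ?case
    using Suc by (simp add: wcomp_def funpow_swap1 mult_ac)
qed simp

text \<open>Holomorphy of \<open>\<phi>\<close> stays outside the locale, so that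
  \<open>w_nonzero\<close> is available while that holomorphy is still to be derived.\<close>

locale supercyclic_wcomp = supercyclic_vector E "wcomp w \<phi>" f for E w \<phi> f +
  assumes maps: "\<phi> ` cdisc \<subseteq> cdisc" and f: "f \<in> cont_disc"
begin

abbreviation orb :: "nat \<Rightarrow> complex \<Rightarrow> complex" where
  "orb n \<equiv> (wcomp w \<phi> ^^ n) f"

lemma orb_Suc: "z \<in> cdisc \<Longrightarrow> orb (Suc n) z = w z * orb n (\<phi> z)"
  by (simp add: wcomp_def)

lemma orb_not_zero:
  assumes "u \<in> cdisc"
  obtains n where "orb n u \<noteq> 0"
proof -
  obtain v :: complex where "v \<in> cdisc" "u \<noteq> v" by (rule that[of "if u = 0 then 1 else 0"]) auto
  from not_dominated[OF assms this, of 0] show ?thesis using that by auto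
qed

text \<open>If \<open>w u = 0\<close>, only \<open>n = 0\<close> gives a nonzero value at
  \<open>u\<close>. The pairs of values at \<open>u\<close> and \<open>v\<close> then fill at most a
  coordinate axis and the line through \<open>(f u, f v)\<close>, which is not dense.\<close>

lemma w_nonzero:
  assumes u: "u \<in> cdisc"
  shows "w u \<noteq> 0"
proof
  assume w0: "w u = 0"
  have zero: "orb n u = 0" if "n \<noteq> 0" for n
    using that orb_Suc[OF u] w0 by (cases n) auto
  obtain v :: complex where v: "v \<in> cdisc" "u \<noteq> v" by (rule that[of "if u = 0 then 1 else 0"]) auto
  show False
  proof (cases "f v = 0")
    case True
    define C where "C = {x :: complex \<times> complex. fst x * snd x = 0}"
    have "closed C"
      unfolding C_def by (intro closed_Collect_eq continuous_intros)
    moreover have "(1, 1) \<notin> C" by (simp add: C_def)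
    ultimately obtain c n where "(c * orb n u, c * orb n v) \<notin> C"
      using orbit_leaves_closed_set[OF u v] by blast
    then show False using True zero[of n] by (cases "n = 0") (auto simp: C_def)
  next
    case False
    \<comment> \<open>With this constant the two sides agree at \<open>n = 0\<close>, while for
      other \<open>n\<close> the right side is zero.\<close>
    obtain n where n: "cmod (f u) / cmod (f v) * cmod (orb n v) < cmod (orb n u)"
      using not_dominated[OF u v] .
    moreover have "0 \<le> cmod (f u) / cmod (f v) * cmod (orb n v)" by simp
    ultimately have "orb n u \<noteq> 0" by (metis norm_zero not_less)
    then have "n = 0" using zero by blast
    then show False using n False by simp
  qed
qed

lemma orb_fixed_point:
  "p \<in> cdisc \<Longrightarrow> \<phi> p = p \<Longrightarrow> orb n p = w p ^ n * f p"
  by (induction n) (auto simp: wcomp_def)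

lemma nonzero_at_fixed_point:
  assumes "p \<in> cdisc" "\<phi> p = p"
  shows "f p \<noteq> 0"
  using orb_not_zero[OF assms(1)] orb_fixed_point[OF assms] by auto

lemma fixed_point_unique:
  assumes u: "u \<in> cdisc" "\<phi> u = u" and v: "v \<in> cdisc" "\<phi> v = v"
  shows "u = v"
proof -
  \<comment> \<open>The claim is symmetric in \<open>u\<close> and \<open>v\<close>; ordering them
    by \<open>cmod (w _)\<close> makes the geometric quotient of orbit values bounded.\<close>
  have False
    if u: "u \<in> cdisc" "\<phi> u = u" and v: "v \<in> cdisc" "\<phi> v = v"
      and "u \<noteq> v" and w: "cmod (w u) \<le> cmod (w v)" for u v
  proof -
    obtain n where "cmod (f u) / cmod (f v) * cmod (orb n v) < cmod (orb n u)"
      using not_dominated[OF u(1) v(1) \<open>u \<noteq> v\<close>] .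
    then have "cmod (f u) * cmod (w v) ^ n < cmod (f u) * cmod (w u) ^ n"
      using nonzero_at_fixed_point[OF v]
      by (simp add: orb_fixed_point[OF u] orb_fixed_point[OF v] norm_mult norm_power mult_ac)
    moreover have "cmod (w u) ^ n \<le> cmod (w v) ^ n" using w by (simp add: power_mono)
    ultimately show False using mult_left_mono[of _ _ "cmod (f u)"] by fastforce
  qed
  from this[OF u v] this[OF v u] show ?thesis using linear by blast
qed

text \<open>With \<open>y = (\<phi> ^^ n) z\<close>, the weights in \<open>orb n z\<close> and
  \<open>orb n (\<phi> z)\<close> agree except for \<open>w z\<close> and \<open>w y\<close>. Their
  quotient is controlled by \<open>w y * f (\<phi> y) / (w z * f y)\<close>, which is bounded
  because \<open>y\<close> stays in \<open>V\<close>; so \<open>\<phi> z \<noteq> z\<close> would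
  contradict \<open>not_dominated\<close>.\<close>

lemma invariant_set_fixed:
  assumes V: "V \<subseteq> cdisc" "\<phi> ` V \<subseteq> V" and w: "w \<in> cont_disc"
    and \<delta>: "0 < \<delta>" "\<And>z. z \<in> V \<Longrightarrow> \<delta> \<le> cmod (f z)" and z: "z \<in> V"
  shows "\<phi> z = z"
proof (rule ccontr)
  assume ne: "\<phi> z \<noteq> z"
  have bdd: "\<exists>B>0. \<forall>x\<in>cdisc. cmod (h x) \<le> B" if "h \<in> cont_disc" for h
    using that compact_imp_bounded[OF compact_continuous_image[of cdisc h]]
    by (auto simp: cont_disc_def bounded_pos)
  obtain A where A: "\<And>x. x \<in> cdisc \<Longrightarrow> cmod (w x) \<le> A" using bdd[OF w] by blast
  obtain B where B: "\<And>x. x \<in> cdisc \<Longrightarrow> cmod (f x) \<le> B" "0 < B" using bdd[OF f] by blast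
  have zc: "z \<in> cdisc" "\<phi> z \<in> cdisc" using V z by blast+
  have wz: "w z \<noteq> 0" using w_nonzero[OF zc(1)] .
  define K where "K = A * B / (cmod (w z) * \<delta>)"
  obtain n where n: "K * cmod (orb n z) < cmod (orb n (\<phi> z))"
    using not_dominated[OF zc(2,1) ne] .
  define P where "P = (\<Prod>j<n. w ((\<phi> ^^ j) z))"
  define y where "y = (\<phi> ^^ n) z"
  have yV: "y \<in> V" unfolding y_def using V(2) z by (induction n) auto
  have yc: "y \<in> cdisc" "\<phi> y \<in> cdisc" using yV V by blast+
  have 1: "orb n z = P * f y" by (simp only: wcomp_funpow[OF maps zc(1)] P_def y_def)
  \<comment> \<open>Both sides are \<open>orb (Suc n) z\<close>: one by peeling off the first
    weight, the other by the product formula.\<close>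
  have 2: "w z * orb n (\<phi> z) = P * w y * f (\<phi> y)"
    unfolding orb_Suc[OF zc(1), symmetric] wcomp_funpow[OF maps zc(1)] by (simp add: P_def y_def)
  \<comment> \<open>The chain starts and ends at the same number, with one strict inequality in
    between.\<close>
  have "A * B * cmod P * \<delta> \<le> A * B * cmod P * cmod (f y)"
    using \<delta>(2)[OF yV] order.trans[OF norm_ge_zero A[OF yc(1)]] B(2)
    by (intro mult_left_mono mult_nonneg_nonneg) auto
  also have "\<dots> = cmod (w z) * (K * cmod (orb n z)) * \<delta>"
    using wz \<delta>(1) by (simp add: 1 K_def norm_mult)
  also have "\<dots> < cmod (w z) * cmod (orb n (\<phi> z)) * \<delta>"
    using n wz \<delta>(1) by simp
  also have "\<dots> = cmod P * (cmod (w y) * cmod (f (\<phi> y))) * \<delta>"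
    using arg_cong[OF 2, of cmod] by (simp add: norm_mult mult_ac)
  also have "\<dots> \<le> cmod P * (A * B) * \<delta>"
    using A[OF yc(1)] B(1)[OF yc(2)] order.trans[OF norm_ge_zero A[OF yc(1)]] \<delta>(1)
    by (intro mult_right_mono mult_left_mono mult_mono) auto
  finally show False by (simp add: mult_ac)
qed

end

text \<open>By continuity \<open>cmod f\<close> is at least \<open>cmod (f p) / 2\<close> on a small
  invariant set at \<open>p\<close>. A point \<open>z \<noteq> p\<close> of that set would be a
  second fixed point.\<close>

lemma not_supercyclic_wcomp:
  assumes E: "interpolates_pairs E" "E \<subseteq> cont_disc"
    and \<phi>: "\<phi> \<in> disc_algebra" "\<phi> ` cdisc \<subseteq> cdisc" and w: "w \<in> cont_disc"
  shows "\<not> tau_p_supercyclic E (wcomp w \<phi>)"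
proof
  assume "tau_p_supercyclic E (wcomp w \<phi>)"
  then obtain f where f: "f \<in> E"
    and cl: "subtopology tau_p E closure_of {fscale c ((wcomp w \<phi> ^^ n) f) | c n. True} = E"
    unfolding tau_p_supercyclic_def by blast
  interpret supercyclic_wcomp E w \<phi> f
    by unfold_locales (use E cl \<phi> f in auto)
  obtain p where p: "p \<in> cdisc" "\<phi> p = p"
    and nb: "\<And>\<epsilon>. 0 < \<epsilon> \<Longrightarrow> \<exists>V \<subseteq> cdisc \<inter> cball p \<epsilon>. \<phi> ` V \<subseteq> V \<and> (\<exists>z\<in>V. z \<noteq> p)"
    using ex_invariant_subset_near_fixed_point[OF \<phi>] by blast
  have fp: "0 < cmod (f p) / 2" using nonzero_at_fixed_point[OF p] by simp
  have "continuous_on cdisc f" using f E(2) by (auto simp: cont_disc_def)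
  from this[unfolded continuous_on_iff, rule_format, OF p(1) fp]
  obtain d where d: "0 < d" "\<And>z. z \<in> cdisc \<Longrightarrow> dist z p < d \<Longrightarrow> dist (f z) (f p) < cmod (f p) / 2"
    by blast
  \<comment> \<open>Half of \<open>d\<close>, because \<open>V\<close> lies in a closed ball and the
    bound from continuity holds on the open one.\<close>
  obtain V z where V: "V \<subseteq> cdisc \<inter> cball p (d / 2)" "\<phi> ` V \<subseteq> V" and z: "z \<in> V" "z \<noteq> p"
    using nb[of "d / 2"] d(1) by auto
  have "cmod (f p) / 2 \<le> cmod (f x)" if "x \<in> V" for x
  proof -
    have "x \<in> cdisc" "dist x p < d" using that V d(1) by (force simp: dist_commute)+
    then have "cmod (f p - f x) < cmod (f p) / 2"
      using d(2)[of x] by (simp add: dist_norm norm_minus_commute)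
    then show ?thesis using norm_triangle_sub[of "f p" "f x"] by linarith
  qed
  then have "\<phi> z = z" using V w z by (intro invariant_set_fixed[OF _ V(2) w fp]) auto
  then show False using fixed_point_unique[of z p] p z V by blast
qed

section \<open>The disc algebra and the Lipschitz spaces\<close>

definition affine_disc :: "complex \<Rightarrow> complex \<Rightarrow> complex \<Rightarrow> complex" where
  "affine_disc a b = (\<lambda>z. if z \<in> cdisc then a + b * z else 0)"

text \<open>Distances \<open>t\<close> in the disc are at most 2, whence \<open>t = t powr \<alpha>
  * t powr (1 - \<alpha>) \<le> 2 * t powr \<alpha>\<close>.\<close>

lemma affine_disc_lip_space:
  assumes \<alpha>: "0 < \<alpha>" "\<alpha> \<le> 1"
  shows "affine_disc a b \<in> lip_space \<alpha>"
proof -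
  have "continuous_on cdisc (affine_disc a b) \<longleftrightarrow> continuous_on cdisc (\<lambda>z. a + b * z)"
    by (intro continuous_on_cong) (auto simp: affine_disc_def)
  moreover have "affine_disc a b holomorphic_on odisc \<longleftrightarrow> (\<lambda>z. a + b * z) holomorphic_on odisc"
    by (intro holomorphic_cong) (auto simp: affine_disc_def)
  ultimately have "affine_disc a b \<in> disc_algebra"
    by (auto simp: disc_algebra_def cont_disc_def affine_disc_def intro!: continuous_intros holomorphic_intros)
  moreover have "cmod (affine_disc a b z - affine_disc a b u) \<le> (2 * cmod b) * cmod (z - u) powr \<alpha>"
    if "z \<in> cdisc" "u \<in> cdisc" for z u
  proof -
    define t where "t = cmod (z - u)"
    have t: "0 \<le> t" "t \<le> 2"
      using that norm_triangle_ineq4[of z u] by (auto simp: t_def)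
    have "t = t powr \<alpha> * t powr (1 - \<alpha>)" using t by (simp flip: powr_add)
    also have "\<dots> \<le> t powr \<alpha> * 2"
    proof (rule mult_left_mono)
      have "t powr (1 - \<alpha>) \<le> 2 powr (1 - \<alpha>)" using t \<alpha> by (intro powr_mono2) auto
      also have "\<dots> \<le> 2 powr 1" using \<alpha> by (intro powr_mono) auto
      finally show "t powr (1 - \<alpha>) \<le> 2" by simp
    qed simp
    finally have "t \<le> 2 * t powr \<alpha>" by (simp add: mult.commute)
    then have "cmod b * t \<le> cmod b * (2 * t powr \<alpha>)" by (rule mult_left_mono) simp
    moreover have "affine_disc a b z - affine_disc a b u = b * (z - u)"
      using that by (simp add: affine_disc_def algebra_simps)
    ultimately show ?thesis by (simp add: norm_mult t_def mult_ac)
  qed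
  ultimately show ?thesis unfolding lip_space_def by blast
qed

lemma affine_interpolates_pairs:
  assumes "\<And>a b. affine_disc a b \<in> E"
  shows "interpolates_pairs E"
  unfolding interpolates_pairs_def
proof (intro ballI impI allI)
  fix u v a b :: complex assume uv: "u \<in> cdisc" "v \<in> cdisc" "u \<noteq> v"
  define m where "m = (b - a) / (v - u)"
  have "m * (v - u) = b - a" using uv by (simp add: m_def)
  then have "affine_disc (a - m * u) m u = a" "affine_disc (a - m * u) m v = b"
    using uv by (auto simp: affine_disc_def algebra_simps)
  then show "\<exists>g\<in>E. g u = a \<and> g v = b" using assms by blast
qed

lemma weighted_comp_op_not_supercyclic:
  assumes E: "E \<subseteq> disc_algebra" "\<And>a b. affine_disc a b \<in> E"
    and T: "topspace T = E" and op: "weighted_comp_op T w \<phi>"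
  shows "\<not> tau_p_supercyclic E (wcomp w \<phi>)"
proof
  assume super: "tau_p_supercyclic E (wcomp w \<phi>)"
  have w: "w \<in> cont_disc" and \<phi>: "\<phi> \<in> cont_disc" and maps: "\<phi> ` cdisc \<subseteq> cdisc"
    and wc: "\<And>g. g \<in> E \<Longrightarrow> wcomp w \<phi> g \<in> E"
    using op T by (auto simp: weighted_comp_op_def continuous_map_def)
  have inter: "interpolates_pairs E" using affine_interpolates_pairs E(2) .
  obtain f where f: "f \<in> E"
    and cl: "subtopology tau_p E closure_of {fscale c ((wcomp w \<phi> ^^ n) f) | c n. True} = E"
    using super unfolding tau_p_supercyclic_def by blast
  interpret supercyclic_wcomp E w \<phi> f
    by unfold_locales (use E inter cl maps f in \<open>auto simp: disc_algebra_def\<close>)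
  have hol: "wcomp w \<phi> (affine_disc a b) holomorphic_on odisc" for a b
    using wc[OF E(2)] E(1) by (auto simp: disc_algebra_def)
  have *: "wcomp w \<phi> (affine_disc a b) z = w z * (a + b * \<phi> z)" if "z \<in> cdisc" for a b z
    using that subsetD[OF maps imageI[OF that]] by (simp add: wcomp_def affine_disc_def)
  \<comment> \<open>The quotient is \<open>w * \<phi>\<close> over \<open>w\<close>, so on the open
    disc it is \<open>\<phi>\<close>.\<close>
  have "(\<lambda>z. wcomp w \<phi> (affine_disc 0 1) z / wcomp w \<phi> (affine_disc 1 0) z) holomorphic_on odisc"
    using w_nonzero by (intro holomorphic_on_divide hol) (simp add: *)
  then have "\<phi> holomorphic_on odisc"
    by (rule holomorphic_transform) (use w_nonzero in \<open>simp add: *\<close>)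
  then have "\<phi> \<in> disc_algebra" using \<phi> E(2) by (simp add: disc_algebra_def)
  then have "\<not> tau_p_supercyclic E (wcomp w \<phi>)"
    using E disc_algebra_cont maps w by (intro not_supercyclic_wcomp inter) auto
  then show False using super by contradiction
qed

theorem theoremB:
  shows "(\<forall>(E :: (complex \<Rightarrow> complex) set) (T :: (complex \<Rightarrow> complex) topology)
            (w :: complex \<Rightarrow> complex) (\<phi> :: complex \<Rightarrow> complex).
            infinite_dimensional E \<and> locally_convex_space E T \<and>
            continuous_map T tau_p (\<lambda>f. f) \<and>
            evaluations_independent E \<and>
            \<phi> \<in> disc_algebra \<and> \<phi> ` cdisc \<subseteq> cdisc \<and> w \<in> cont_disc \<and>
            continuous_map T T (wcomp w \<phi>)
            \<longrightarrow> \<not> tau_p_supercyclic E (wcomp w \<phi>)) \<and>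
         (\<forall>w \<phi>. weighted_comp_op (norm_topology disc_algebra sup_norm) w \<phi>
            \<longrightarrow> \<not> tau_p_supercyclic disc_algebra (wcomp w \<phi>)) \<and>
         (\<forall>(\<alpha> :: real) w \<phi>. 0 < \<alpha> \<and> \<alpha> \<le> 1 \<and>
            weighted_comp_op (norm_topology (lip_space \<alpha>) (lip_norm \<alpha>)) w \<phi>
            \<longrightarrow> \<not> tau_p_supercyclic (lip_space \<alpha>) (wcomp w \<phi>))"
proof (intro conjI allI impI)
  fix E T w \<phi>
  assume A: "infinite_dimensional E \<and> locally_convex_space E T \<and>
            continuous_map T tau_p (\<lambda>f. f) \<and>
            evaluations_independent E \<and>
            \<phi> \<in> disc_algebra \<and> \<phi> ` cdisc \<subseteq> cdisc \<and> w \<in> cont_disc \<and>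
            continuous_map T T (wcomp w \<phi>)"
  then have "cfun.subspace E" "E \<subseteq> cont_disc"
    by (auto simp: locally_convex_space_def continuous_map_tau_p Pi_iff)
  then show "\<not> tau_p_supercyclic E (wcomp w \<phi>)"
    using A by (intro not_supercyclic_wcomp evaluations_independent_interpolates_pairs) auto
next
  fix w \<phi> assume "weighted_comp_op (norm_topology disc_algebra sup_norm) w \<phi>"
  then show "\<not> tau_p_supercyclic disc_algebra (wcomp w \<phi>)"
    \<comment> \<open>Affine functions belong to the disc algebra because they lie in the Lipschitz
      space of exponent 1.\<close>
    by (rule weighted_comp_op_not_supercyclic[rotated -1])
      (use affine_disc_lip_space[of 1] lip_space_disc_algebra in
        \<open>auto simp: norm_topology_def Metric_space.topspace_mtopology[OF Metric_space_disc_algebra]\<close>)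
next
  fix \<alpha> :: real and w \<phi>
  assume A: "0 < \<alpha> \<and> \<alpha> \<le> 1 \<and> weighted_comp_op (norm_topology (lip_space \<alpha>) (lip_norm \<alpha>)) w \<phi>"
  show "\<not> tau_p_supercyclic (lip_space \<alpha>) (wcomp w \<phi>)"
    by (rule weighted_comp_op_not_supercyclic[of _ "norm_topology (lip_space \<alpha>) (lip_norm \<alpha>)"])
      (use A affine_disc_lip_space lip_space_disc_algebra in
        \<open>auto simp: norm_topology_def Metric_space.topspace_mtopology[OF Metric_space_lip_space]\<close>)
qed

end
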